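(* Let $h\in\mathbb{R}^n$ and let a polynomial $g\in\mathbb{R}[X_1,\dots,X_n]$ be given as a finite sum $g=\sum_\alpha b_\alpha(X-h)^{2\alpha}$ ($\alpha\in\mathbb{N}_0^n$) with $b_\alpha\in\mathbb{R}$ and $b_\alpha\ge0$ for all $\alpha\ne0$. 1. For every $k\in\{1,\dots,n\}$ and every fixed $x\in\mathbb{R}^n$, the univariate function $y\mapsto g(x_1,\dots,x_{k-1},y,x_{k+1},\dots,x_n)$ is nonincreasing for $y\le h_k$ and nondecreasing for $y\ge h_k$. 2. For every $x\in\mathbb{Z}^n$ and every $k\in\{1,\dots,n\}$, $g(x_1,\dots,x_n)\ge g(x_1,\dots,x_{k-1},\lfloor h_k\rceil,x_{k+1},\dots,x_n)$. 3. $h$ is a continuous minimizer of $g$ and $\lfloor h\rceil$ is an integer minimizer of $g$.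
   Context: $(X-h)^{2\alpha}:=\prod_{j=1}^n(X_j-h_j)^{2\alpha_j}$. For $h\in\mathbb{R}^n$, $\lfloor h\rceil\in\mathbb{Z}^n$ denotes the vector obtained by rounding each component of $h$ to its nearest integer. A continuous (resp. integer) minimizer of $g$ is a point at which $g$ attains its minimum over $\mathbb{R}^n$ (resp. $\mathbb{Z}^n$). *)

theory Defs
  imports "HOL-Analysis.Analysis" "HOL-Library.Poly_Mapping"
begin

text \<open>
  The polynomial ring over the reals in finitely many indeterminates, indexed by the type
  \<open>'n\<close>, is the monoid algebra of the additive monoid of exponent vectors: a polynomial
  is its finitely supported coefficient function, and the ring operations (with convolution
  as product) are the instances for \<open>poly_mapping\<close>.
\<close>

type_synonym 'n mpoly = "(nat^'n) \<Rightarrow>\<^sub>0 real"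

definition mconst :: "real \<Rightarrow> 'n::finite mpoly" where
  "mconst c = Poly_Mapping.single 0 c"

definition mvar :: "'n::finite \<Rightarrow> 'n mpoly" where
  "mvar j = Poly_Mapping.single (axis j 1) 1"

definition meval :: "'n::finite mpoly \<Rightarrow> real^'n \<Rightarrow> real" where
  "meval p x =
    (\<Sum>\<alpha>\<in>Poly_Mapping.keys p. Poly_Mapping.lookup p \<alpha> * (\<Prod>j\<in>UNIV. (x $ j) ^ (\<alpha> $ j)))"

definition shifted_even_monom :: "real^'n::finite \<Rightarrow> nat^'n \<Rightarrow> 'n mpoly" where
  "shifted_even_monom h \<alpha> = (\<Prod>j\<in>UNIV. (mvar j - mconst (h $ j)) ^ (2 * (\<alpha> $ j)))"

definition replace_coord :: "'a^'n::finite \<Rightarrow> 'n \<Rightarrow> 'a \<Rightarrow> 'a^'n" where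
  "replace_coord x k y = (\<chi> j. if j = k then y else x $ j)"

definition int_points :: "(real^'n::finite) set" where
  "int_points = {x. \<forall>j. x $ j \<in> \<int>}"

text \<open>
  Rounding to a nearest integer leaves a choice at half-integers. The predicate admits any
  choice; \<open>round\<close>, which rounds half-integers up, is one instance.
\<close>

definition nearest_int_rounding :: "(real \<Rightarrow> int) \<Rightarrow> bool" where
  "nearest_int_rounding rnd \<longleftrightarrow>
    (\<forall>t. \<forall>m::int. \<bar>t - of_int (rnd t)\<bar> \<le> \<bar>t - of_int m\<bar>)"

lemma nearest_int_rounding_round: "nearest_int_rounding round"
  by (simp add: nearest_int_rounding_def round_diff_minimal)

definition round_vec :: "(real \<Rightarrow> int) \<Rightarrow> real^'n::finite \<Rightarrow> real^'n" where
  "round_vec rnd h = (\<chi> j. of_int (rnd (h $ j)))"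

definition continuous_minimizer :: "'n::finite mpoly \<Rightarrow> real^'n \<Rightarrow> bool" where
  "continuous_minimizer g x \<longleftrightarrow> is_arg_min (meval g) (\<lambda>y. y \<in> UNIV) x"

definition integer_minimizer :: "'n::finite mpoly \<Rightarrow> real^'n \<Rightarrow> bool" where
  "integer_minimizer g x \<longleftrightarrow> is_arg_min (meval g) (\<lambda>y. y \<in> int_points) x"

end

theory Submission
  imports Defs
begin

text \<open>
  Evaluation at a point is a ring homomorphism, so \<open>g\<close> evaluates to the expected sum of
  the terms \<open>b \<alpha> * (\<Prod>j. (x $ j - h $ j) ^ (2 * \<alpha> $ j))\<close>. Because all exponents are even,
  each such product depends only on the distances \<open>\<bar>x $ j - h $ j\<bar>\<close> and is monotone in each
  of them; the constant term, whose coefficient may have any sign, does not vary. Hence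
  \<open>g\<close> is monotone in the vector of coordinatewise distances to \<open>h\<close>
  (\<open>meval_mono_coord_dist\<close>). Every claim is an instance of this one comparison: moving a
  coordinate towards \<open>h $ k\<close> decreases its distance, the distances vanish at \<open>h\<close>, and
  rounding minimises each distance among the integers.
\<close>

text \<open>
  A sum over any finite superset of the support allows polynomials with different
  supports to be compared term by term.
\<close>

lemma meval_superset:
  assumes "finite S" "Poly_Mapping.keys p \<subseteq> S"
  shows "meval p x =
    (\<Sum>\<alpha>\<in>S. Poly_Mapping.lookup p \<alpha> * (\<Prod>j\<in>UNIV. (x $ j) ^ (\<alpha> $ j)))"
  unfolding meval_def
  by (rule sum.mono_neutral_left) (use assms in \<open>auto simp: in_keys_iff\<close>)

lemma meval_add: "meval (p + q) x = meval p x + meval q x"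
proof -
  let ?S = "Poly_Mapping.keys p \<union> Poly_Mapping.keys q"
  have "meval (p + q) x =
      (\<Sum>\<alpha>\<in>?S. Poly_Mapping.lookup (p + q) \<alpha> * (\<Prod>j\<in>UNIV. (x $ j) ^ (\<alpha> $ j)))"
    by (rule meval_superset) (auto simp: in_keys_iff lookup_add)
  also have "\<dots> = meval p x + meval q x"
    by (simp add: meval_superset[of ?S] lookup_add algebra_simps sum.distrib)
  finally show ?thesis .
qed

lemma meval_single:
  "meval (Poly_Mapping.single \<alpha> c) x = c * (\<Prod>j\<in>UNIV. (x $ j) ^ (\<alpha> $ j))"
  by (simp add: meval_superset[of "{\<alpha>}"])

lemma meval_zero: "meval 0 x = 0"
  by (simp add: meval_def)

lemma meval_diff: "meval (p - q) x = meval p x - meval q x"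
  using meval_add[of "p - q" q x] by simp

lemma poly_mapping_single_add_induct [case_names zero add_single]:
  fixes p :: "'a \<Rightarrow>\<^sub>0 'b::comm_monoid_add"
  assumes "P 0" and add_single: "\<And>a c q. P q \<Longrightarrow> P (Poly_Mapping.single a c + q)"
  shows "P p"
proof (induction p rule: update_induct)
  case (update q a c)
  then have "Poly_Mapping.update a c q = Poly_Mapping.single a c + q"
    by (intro poly_mapping_eqI)
       (auto simp: lookup_update lookup_add lookup_single in_keys_iff when_def)
  with add_single[OF update.IH] show ?case by simp
qed (rule assms)

text \<open>
  Both sides are additive in \<open>p\<close> and in \<open>q\<close>, which reduces the claim to two
  monomials; there the exponents add.
\<close>

lemma meval_mult: "meval (p * q) x = meval p x * meval q x"
proof (induction p rule: poly_mapping_single_add_induct)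
  case (add_single \<alpha> c p)
  have "meval (Poly_Mapping.single \<alpha> c * q) x = meval (Poly_Mapping.single \<alpha> c) x * meval q x"
  proof (induction q rule: poly_mapping_single_add_induct)
    case (add_single \<beta> d q)
    then show ?case
      by (simp add: distrib_left meval_add mult_single meval_single power_add prod.distrib)
  qed (simp add: meval_zero)
  with add_single show ?case
    by (simp add: distrib_right meval_add)
qed (simp add: meval_zero)

lemma meval_mconst: "meval (mconst c) x = c"
  by (simp add: mconst_def meval_single)

lemma meval_one: "meval 1 x = 1"
  using meval_mconst[of 1 x] by (simp add: mconst_def)

lemma meval_mvar: "meval (mvar k) x = x $ k"
proof -
  have "(\<Prod>j\<in>UNIV. (x $ j) ^ (axis k (1::nat) $ j)) = (\<Prod>j\<in>UNIV. if j = k then x $ j else 1)"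
    by (rule prod.cong) (auto simp: axis_def)
  then show ?thesis
    by (simp add: mvar_def meval_single)
qed

lemma meval_power: "meval (p ^ m) x = meval p x ^ m"
  by (induction m) (simp_all add: meval_one meval_mult)

lemma meval_sum: "meval (\<Sum>i\<in>I. f i) x = (\<Sum>i\<in>I. meval (f i) x)"
  by (induction I rule: infinite_finite_induct) (simp_all add: meval_zero meval_add)

lemma meval_prod: "meval (\<Prod>i\<in>I. f i) x = (\<Prod>i\<in>I. meval (f i) x)"
  by (induction I rule: infinite_finite_induct) (simp_all add: meval_one meval_mult)

lemma meval_shifted_even_monom:
  "meval (shifted_even_monom h \<alpha>) x = (\<Prod>j\<in>UNIV. (x $ j - h $ j) ^ (2 * (\<alpha> $ j)))"
  by (simp add: shifted_even_monom_def meval_prod meval_power meval_diff meval_mvar meval_mconst)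

text \<open>
  An even power of a number is the same power of its absolute value, so every factor is
  nonnegative and grows with the distance.
\<close>

lemma meval_shifted_even_monom_mono:
  assumes "\<And>j. \<bar>x $ j - h $ j\<bar> \<le> \<bar>y $ j - h $ j\<bar>"
  shows "meval (shifted_even_monom h \<alpha>) x \<le> meval (shifted_even_monom h \<alpha>) y"
  unfolding meval_shifted_even_monom
proof (rule prod_mono)
  fix j
  have "\<bar>x $ j - h $ j\<bar> ^ (2 * (\<alpha> $ j)) \<le> \<bar>y $ j - h $ j\<bar> ^ (2 * (\<alpha> $ j))"
    by (rule power_mono) (simp_all add: assms)
  then show "0 \<le> (x $ j - h $ j) ^ (2 * (\<alpha> $ j)) \<and>
      (x $ j - h $ j) ^ (2 * (\<alpha> $ j)) \<le> (y $ j - h $ j) ^ (2 * (\<alpha> $ j))"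
    by (simp add: power_even_abs)
qed

text \<open>
  The nonconstant terms are monotone in the distances since their coefficients are
  nonnegative; the term with exponent \<open>0\<close> takes the same value at both points,
  whatever its coefficient.
\<close>

lemma meval_mono_coord_dist:
  assumes nonneg: "\<And>\<alpha>. \<alpha> \<in> A \<Longrightarrow> \<alpha> \<noteq> 0 \<Longrightarrow> b \<alpha> \<ge> 0"
    and closer: "\<And>j. \<bar>x $ j - h $ j\<bar> \<le> \<bar>y $ j - h $ j\<bar>"
  shows "meval (\<Sum>\<alpha>\<in>A. mconst (b \<alpha>) * shifted_even_monom h \<alpha>) x
       \<le> meval (\<Sum>\<alpha>\<in>A. mconst (b \<alpha>) * shifted_even_monom h \<alpha>) y"
  unfolding meval_sum meval_mult meval_mconst
proof (rule sum_mono)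
  fix \<alpha> assume "\<alpha> \<in> A"
  show "b \<alpha> * meval (shifted_even_monom h \<alpha>) x \<le> b \<alpha> * meval (shifted_even_monom h \<alpha>) y"
  proof (cases "\<alpha> = 0")
    case True
    then show ?thesis by (simp add: meval_shifted_even_monom)
  next
    case False
    with \<open>\<alpha> \<in> A\<close> show ?thesis
      by (intro mult_left_mono meval_shifted_even_monom_mono closer nonneg)
  qed
qed

theorem proposition11:
  fixes h :: "real^'n::finite"
    and A :: "(nat^'n) set"
    and b :: "nat^'n \<Rightarrow> real"
    and g :: "'n mpoly"
    and rnd :: "real \<Rightarrow> int"
  assumes "finite A"
    and "g = (\<Sum>\<alpha>\<in>A. mconst (b \<alpha>) * shifted_even_monom h \<alpha>)"
    and "\<And>\<alpha>. \<alpha> \<in> A \<Longrightarrow> \<alpha> \<noteq> 0 \<Longrightarrow> b \<alpha> \<ge> 0"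
    and "nearest_int_rounding rnd"
  shows "(\<forall>k x. antimono_on {..h $ k} (\<lambda>y. meval g (replace_coord x k y)) \<and>
                mono_on {h $ k..} (\<lambda>y. meval g (replace_coord x k y)))
       \<and> (\<forall>x\<in>int_points. \<forall>k.
            meval g x \<ge> meval g (replace_coord x k (of_int (rnd (h $ k)))))
       \<and> continuous_minimizer g h
       \<and> integer_minimizer g (round_vec rnd h)"
proof -
  have mono: "meval g x \<le> meval g y"
    if "\<And>j. \<bar>x $ j - h $ j\<bar> \<le> \<bar>y $ j - h $ j\<bar>" for x y
    unfolding assms(2) by (rule meval_mono_coord_dist[OF assms(3) that])
  have nearest: "\<bar>of_int (rnd (h $ j)) - h $ j\<bar> \<le> \<bar>x $ j - h $ j\<bar>"
    if "x \<in> int_points" for x :: "real^'n" and j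
  proof -
    from that obtain m :: int where "x $ j = of_int m"
      by (auto simp: int_points_def elim: Ints_cases)
    then show ?thesis
      using assms(4) unfolding nearest_int_rounding_def by (metis abs_minus_commute)
  qed
  have "antimono_on {..h $ k} (\<lambda>y. meval g (replace_coord x k y))" for k x
    by (intro monotone_onI mono) (simp add: replace_coord_def)
  moreover have "mono_on {h $ k..} (\<lambda>y. meval g (replace_coord x k y))" for k x
    by (intro monotone_onI mono) (simp add: replace_coord_def)
  moreover have "meval g (replace_coord x k (of_int (rnd (h $ k)))) \<le> meval g x"
    if "x \<in> int_points" for x k
    by (rule mono) (simp add: replace_coord_def nearest[OF that])
  moreover have "continuous_minimizer g h"
    by (auto simp: continuous_minimizer_def is_arg_min_linorder intro!: mono)
  moreover have "integer_minimizer g (round_vec rnd h)"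
  proof -
    have "round_vec rnd h \<in> int_points"
      by (simp add: round_vec_def int_points_def)
    moreover have "meval g (round_vec rnd h) \<le> meval g x" if "x \<in> int_points" for x
      by (rule mono) (simp add: round_vec_def nearest[OF that])
    ultimately show ?thesis
      by (simp add: integer_minimizer_def is_arg_min_linorder)
  qed
  ultimately show ?thesis by blast
qed

end
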